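(* Let $n,k$ be positive integers, let $m$ be a real number, and put $\varepsilon = \frac{2(k/2-m)}{k}$. Let $f\in\Phi^{n,k}_m$ and let $D$ be any DNF of $f$ (consisting of prime implicants of $f$). Then $$\operatorname{rank} D > \frac{10}{3}n-\frac{5n\varepsilon}{3(1+\varepsilon)}\quad\text{if }\ \varepsilon\le \frac14,$$ $$\operatorname{rank} D > \frac{10}{3}n-\frac{13n\varepsilon}{9+3\varepsilon}\quad\text{if }\ \frac14<\varepsilon<\frac13 .$$
   Context: For a Boolean function $f:\{0,1\}^n\to\{0,1\}$ with exactly $k$ zeros (points where $f=0$), the zero matrix $M_f$ is the $k\times n$ 0/1-matrix whose rows are the $k$ distinct zeros of $f$; it is determined up to the order of its rows. The function $f$ is called reduced if $M_f$ has no all-zero column and no all-one column, no two columns of $M_f$ (at different positions) are equal, and no two columns of $M_f$ are coordinatewise negations of each other. Two points of $\{0,1\}^n$ are adjacent if their Hamming distance is 1. The weight of a 0/1-vector is the minimum of its number of ones and its number of zeros. $\Phi^{n,k}$ is the set of reduced Boolean functions of $n$ variables with exactly $k$ zeros, no two of which are adjacent, and such that in every column of $M_f$ the number of ones does not exceed the number of zeros. $\Phi^{n,k}_\lambda$ is the set of those $f\in\Phi^{n,k}$ for which every column of $M_f$ has weight at least $\lambda$. A literal is a variable $x_i$ or its negation $\bar x_i$; a conjunction is a product of literals in distinct variables; a DNF of $f$ is a disjunction of conjunctions representing $f$. A conjunction $K$ is an implicant of $f$ if every point where $K=1$ satisfies $f=1$; it is prime if deleting any literal from $K$ gives a conjunction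 that is not an implicant of $f$. The rank of $D$, $\operatorname{rank} D$, is the total number of literal occurrences in $D$ (the sum over the conjunctions of $D$ of their numbers of literals). By standing convention all DNFs considered consist of prime implicants. *)

theory Defs
  imports Complex_Main "HOL-Library.Cardinality"
begin

text \<open>
  Points of $\{0,1\}^n$ are functions \<open>'n \<Rightarrow> bool\<close> on a finite index type with \<open>n = CARD('n)\<close>.
\<close>

type_synonym 'n point = "'n \<Rightarrow> bool"
type_synonym 'n boolfun = "'n point \<Rightarrow> bool"

definition zeros :: "'n boolfun \<Rightarrow> 'n point set" where
  "zeros f = {x. \<not> f x}"

definition hamming_dist :: "'n::finite point \<Rightarrow> 'n point \<Rightarrow> nat" where
  "hamming_dist x y = card {i. x i \<noteq> y i}"

definition adjacent :: "'n::finite point \<Rightarrow> 'n point \<Rightarrow> bool" where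
  "adjacent x y \<longleftrightarrow> hamming_dist x y = 1"

text \<open>
  A matrix is the list of its rows. The zero matrix is unique only up to the order of its rows;
  one order is chosen, and every property of it used below is invariant under row permutations.
\<close>

definition zero_matrix :: "'n::finite boolfun \<Rightarrow> 'n point list" where
  "zero_matrix f = (SOME M. distinct M \<and> set M = zeros f)"

lemma zero_matrix:
  "distinct (zero_matrix f)" "set (zero_matrix f) = zeros f"
proof -
  have "\<exists>M. distinct M \<and> set M = zeros f"
    using finite_distinct_list[of "zeros f"] by auto
  then have "distinct (zero_matrix f) \<and> set (zero_matrix f) = zeros f"
    unfolding zero_matrix_def by (rule someI_ex)
  then show "distinct (zero_matrix f)" "set (zero_matrix f) = zeros f" by auto
qed

lemma length_zero_matrix: "length (zero_matrix f) = card (zeros f)"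
  by (metis zero_matrix distinct_card)

definition matrix_col :: "'n point list \<Rightarrow> 'n \<Rightarrow> bool list" where
  "matrix_col M i = map (\<lambda>x. x i) M"

definition ones_count :: "bool list \<Rightarrow> nat" where
  "ones_count c = count_list c True"

definition zeros_count :: "bool list \<Rightarrow> nat" where
  "zeros_count c = count_list c False"

definition weight :: "bool list \<Rightarrow> nat" where
  "weight c = min (ones_count c) (zeros_count c)"

definition reduced :: "'n::finite boolfun \<Rightarrow> bool" where
  "reduced f \<longleftrightarrow> (let M = zero_matrix f in
     (\<forall>i. matrix_col M i \<noteq> replicate (length M) False) \<and>
     (\<forall>i. matrix_col M i \<noteq> replicate (length M) True) \<and>
     (\<forall>i j. i \<noteq> j \<longrightarrow> matrix_col M i \<noteq> matrix_col M j) \<and>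
     (\<forall>i j. i \<noteq> j \<longrightarrow> matrix_col M i \<noteq> map Not (matrix_col M j)))"

definition Phi :: "nat \<Rightarrow> 'n::finite boolfun set" where
  "Phi k = {f. reduced f \<and> card (zeros f) = k \<and>
     (\<forall>x\<in>zeros f. \<forall>y\<in>zeros f. \<not> adjacent x y) \<and>
     (\<forall>i. ones_count (matrix_col (zero_matrix f) i) \<le> zeros_count (matrix_col (zero_matrix f) i))}"

definition Phi_ge :: "nat \<Rightarrow> real \<Rightarrow> 'n::finite boolfun set" where
  "Phi_ge k l = {f \<in> Phi k. \<forall>i. real (weight (matrix_col (zero_matrix f) i)) \<ge> l}"

datatype 'n lit = PosLit (lit_var: 'n) | NegLit (lit_var: 'n)

fun eval_lit :: "'n lit \<Rightarrow> 'n point \<Rightarrow> bool" where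
  "eval_lit (PosLit i) x = x i"
| "eval_lit (NegLit i) x = (\<not> x i)"

text \<open>The injectivity condition says that the literals of a conjunction are in distinct variables.\<close>

definition conjunction :: "'n lit set \<Rightarrow> bool" where
  "conjunction K \<longleftrightarrow> inj_on lit_var K"

definition eval_conj :: "'n lit set \<Rightarrow> 'n point \<Rightarrow> bool" where
  "eval_conj K x \<longleftrightarrow> (\<forall>l\<in>K. eval_lit l x)"

definition implicant :: "'n boolfun \<Rightarrow> 'n lit set \<Rightarrow> bool" where
  "implicant f K \<longleftrightarrow> conjunction K \<and> (\<forall>x. eval_conj K x \<longrightarrow> f x)"

definition prime_implicant :: "'n boolfun \<Rightarrow> 'n lit set \<Rightarrow> bool" where
  "prime_implicant f K \<longleftrightarrow> implicant f K \<and> (\<forall>l\<in>K. \<not> implicant f (K - {l}))"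

text \<open>A DNF is a list of conjunctions, so repeated conjunctions are allowed and counted in the rank.\<close>

definition is_DNF :: "'n lit set list \<Rightarrow> 'n boolfun \<Rightarrow> bool" where
  "is_DNF D f \<longleftrightarrow> (\<forall>K\<in>set D. conjunction K) \<and> (\<forall>x. f x \<longleftrightarrow> (\<exists>K\<in>set D. eval_conj K x))"

definition is_prime_DNF :: "'n lit set list \<Rightarrow> 'n boolfun \<Rightarrow> bool" where
  "is_prime_DNF D f \<longleftrightarrow> is_DNF D f \<and> (\<forall>K\<in>set D. prime_implicant f K)"

definition dnf_rank :: "'n lit set list \<Rightarrow> nat" where
  "dnf_rank D = sum_list (map card D)"

end

theory Submission
  imports Defs
begin

text \<open>
  Say that a literal kills a zero of \<open>f\<close> if it is false there. Every literal kills at least \<open>m\<close> of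
  the \<open>k\<close> zeros, and every conjunction of the DNF must kill all of them. Flipping one coordinate of a
  zero \<open>z\<close> gives a one of \<open>f\<close>, and the conjunction that covers this neighbour contains the flipped
  variable's literal killing \<open>z\<close>, and no other literal that kills \<open>z\<close>. So each of the \<open>n k\<close> pairs
  (zero, variable) needs a conjunction in which that variable is the sole killer of that zero
  (\<open>neighbour_covered\<close>), and a conjunction serves at most one pair for each zero that it kills just
  once (\<open>sum_killed_once_ge\<close>).

  Call a literal single if it occurs only once in the DNF. In its conjunction it is then
  the sole killer of all zeros that it kills, so the other literals only kill among the at most
  \<open>k - m\<close> remaining zeros. As the function is reduced, there are at least two other literals; as each of them
  kills at least \<open>m\<close> zeros, they overlap a lot, and the conjunction kills at most \<open>2 k - 3 m\<close>
  zeros just once (\<open>killed_once_le_of_single\<close>). Moreover, when \<open>3 m > k\<close>, that is \<open>\<epsilon> < 1/3\<close>, no conjunction contains two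
  single literals (\<open>single_unique\<close>).

  Let \<open>N\<close> be the number of conjunctions and \<open>s\<close> the number of those with a single literal. All
  \<open>2 n\<close> literals occur, and at most \<open>s\<close> of them just once, so the rank is at least \<open>4 n - s\<close>. All
  conjunctions have at least two literals and \<open>s\<close> of them at least three, so the rank is at least
  \<open>2 N + s\<close>, where \<open>s (2 k - 3 m) + (N - s) k \<ge> n k\<close> by the count of pairs. Few single literals
  make the first bound good, many make the second good. Eliminating \<open>s\<close> and \<open>N\<close> gives
  \<open>rank \<ge> 10 n / 3 - 2 n \<epsilon> / (3 (1 - \<epsilon>))\<close>, which is stronger than both required bounds when
  \<open>0 < \<epsilon> < 1/3\<close>. For \<open>\<epsilon> = 0\<close> the bounds are strict because then there are no single literals,
  so the rank is at least \<open>4 n\<close>.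
\<close>

section \<open>Zeros killed by a literal\<close>

definition kill :: "'n boolfun \<Rightarrow> 'n lit \<Rightarrow> 'n point set" where
  "kill f l = {z \<in> zeros f. \<not> eval_lit l z}"

lemma kill_subset: "kill f l \<subseteq> zeros f"
  by (auto simp: kill_def)

lemma finite_kill [simp]: "finite (kill (f :: 'n::finite boolfun) l)"
  by (simp add: kill_def)

lemma count_list_matrix_col:
  "count_list (matrix_col (zero_matrix f) i) b = card {z \<in> zeros f. z i = b}"
proof -
  have "count_list (matrix_col (zero_matrix f) i) b = length (filter (\<lambda>z. z i = b) (zero_matrix f))"
    by (simp add: matrix_col_def count_list_eq_length_filter filter_map comp_def eq_commute)
  also have "\<dots> = card (set (filter (\<lambda>z. z i = b) (zero_matrix f)))"
    using zero_matrix(1) by (metis distinct_card distinct_filter)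
  finally show ?thesis by (simp add: zero_matrix(2))
qed

lemma matrix_col_eq_replicate_iff:
  "matrix_col (zero_matrix f) i = replicate (length (zero_matrix f)) b
    \<longleftrightarrow> (\<forall>z\<in>zeros f. z i = b)"
  by (simp add: matrix_col_def zero_matrix(2) flip: map_replicate_const)

lemma weight_le_card_kill: "weight (matrix_col (zero_matrix f) (lit_var l)) \<le> card (kill f l)"
  by (cases l)
    (simp_all add: weight_def ones_count_def zeros_count_def count_list_matrix_col kill_def)

lemma weight_le_half: "2 * weight (matrix_col (zero_matrix f) i) \<le> card (zeros f)"
proof -
  have "card {z \<in> zeros f. z i} + card {z \<in> zeros f. \<not> z i}
      = card ({z \<in> zeros f. z i} \<union> {z \<in> zeros f. \<not> z i})"
    by (subst card_Un_disjoint) auto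
  also have "{z \<in> zeros f. z i} \<union> {z \<in> zeros f. \<not> z i} = zeros f" by auto
  finally show ?thesis
    by (simp add: weight_def ones_count_def zeros_count_def count_list_matrix_col)
qed

lemma reduced_kill:
  assumes "reduced f"
  shows "kill f l \<noteq> {}" "kill f l \<noteq> zeros f"
proof -
  have "matrix_col (zero_matrix f) i \<noteq> replicate (length (zero_matrix f)) b" for i b
    using assms unfolding reduced_def Let_def by (cases b) simp_all
  then have "\<exists>z\<in>zeros f. z i = (\<not> b)" for i b
    using matrix_col_eq_replicate_iff[of f i b] by auto
  then obtain y z where "y \<in> zeros f" "z \<in> zeros f" "y (lit_var l) = True" "z (lit_var l) = False"
    by (metis (full_types))
  moreover from this have "eval_lit l y \<noteq> eval_lit l z" by (cases l) simp_all
  ultimately show "kill f l \<noteq> {}" "kill f l \<noteq> zeros f"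
    unfolding kill_def by blast+
qed

lemma reduced_kill_not_complement:
  assumes "reduced f" "lit_var l \<noteq> lit_var l'"
  shows "kill f l' \<noteq> zeros f - kill f l"
proof
  assume eq: "kill f l' = zeros f - kill f l"
  have "z \<in> kill f l' \<longleftrightarrow> z \<notin> kill f l" if "z \<in> zeros f" for z
    using eq that by blast
  then have "(\<forall>z\<in>zeros f. z (lit_var l) = z (lit_var l')) \<or>
      (\<forall>z\<in>zeros f. z (lit_var l) = (\<not> z (lit_var l')))"
    by (cases l; cases l'; auto simp: kill_def)
  then have "matrix_col (zero_matrix f) (lit_var l) = matrix_col (zero_matrix f) (lit_var l') \<or>
      matrix_col (zero_matrix f) (lit_var l) = map Not (matrix_col (zero_matrix f) (lit_var l'))"
    by (simp add: matrix_col_def zero_matrix(2))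
  then show False using assms unfolding reduced_def Let_def by metis
qed

lemma not_zero_flip:
  assumes "\<forall>x\<in>zeros f. \<forall>y\<in>zeros f. \<not> adjacent x y" "z \<in> zeros f"
  shows "f (z(i := \<not> z i))"
proof -
  have "{j. z j \<noteq> (z(i := \<not> z i)) j} = {i}" by auto
  then have "adjacent z (z(i := \<not> z i))" by (simp add: adjacent_def hamming_dist_def)
  then show ?thesis using assms by (auto simp: zeros_def)
qed

lemma lit_UNIV: "(UNIV :: 'n lit set) = range PosLit \<union> range NegLit"
proof -
  have "l \<in> range PosLit \<union> range NegLit" for l :: "'n lit" by (cases l) simp_all
  then show ?thesis by blast
qed

lemma finite_lit [simp]: "finite (A :: 'n::finite lit set)"
proof -
  have "finite (UNIV :: 'n lit set)" unfolding lit_UNIV by simp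
  then show ?thesis by (rule finite_subset[OF subset_UNIV])
qed

lemma card_lit: "card (UNIV :: 'n::finite lit set) = 2 * CARD('n)"
proof -
  have "range PosLit \<inter> range NegLit = ({} :: 'n lit set)" by blast
  then have "card (UNIV :: 'n lit set) = card (range (PosLit :: 'n \<Rightarrow> 'n lit)) + card (range (NegLit :: 'n \<Rightarrow> 'n lit))"
    using card_Un_disjoint[OF finite_lit finite_lit] lit_UNIV by metis
  moreover have "inj (PosLit :: 'n \<Rightarrow> 'n lit)" "inj (NegLit :: 'n \<Rightarrow> 'n lit)"
    by (simp_all add: inj_def)
  ultimately show ?thesis by (simp add: card_image)
qed

section \<open>Single literals and zeros killed once\<close>

locale heavy_DNF =
  fixes f :: "'n::finite boolfun" and D :: "'n lit set list" and m :: real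
  assumes DNF: "is_DNF D f"
    and reduced: "reduced f"
    and nonadjacent: "\<forall>x\<in>zeros f. \<forall>y\<in>zeros f. \<not> adjacent x y"
    and heavy: "\<And>l. m \<le> card (kill f l)"
    and third: "3 * m > card (zeros f)"
begin

abbreviation k :: nat where "k \<equiv> card (zeros f)"

definition occs :: "'n lit \<Rightarrow> nat set" where
  "occs l = {j. j < length D \<and> l \<in> D ! j}"

definition single :: "'n lit \<Rightarrow> bool" where
  "single l \<longleftrightarrow> card (occs l) = 1"

definition killed_once :: "nat \<Rightarrow> 'n point set" where
  "killed_once j = {z \<in> zeros f. \<exists>!l. l \<in> D ! j \<and> z \<in> kill f l}"

definition single_clauses :: "nat set" where
  "single_clauses = {j. j < length D \<and> (\<exists>l\<in>D ! j. single l)}"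

lemma finite_occs [simp]: "finite (occs l)"
  by (simp add: occs_def)

lemma clause_vars_distinct:
  assumes "j < length D" "l \<in> D ! j" "l' \<in> D ! j" "l \<noteq> l'"
  shows "lit_var l \<noteq> lit_var l'"
  using DNF assms unfolding is_DNF_def conjunction_def by (metis inj_onD nth_mem)

lemma clause_kills_all:
  assumes "j < length D" "z \<in> zeros f"
  shows "\<exists>l\<in>D ! j. z \<in> kill f l"
proof -
  have "\<not> eval_conj (D ! j) z"
    using DNF assms unfolding is_DNF_def zeros_def by (auto dest: nth_mem)
  then show ?thesis using assms(2) by (auto simp: eval_conj_def kill_def)
qed

text \<open>
  The conjunction covering the neighbour of \<open>z\<close> in direction \<open>lit_var l\<close> does not cover \<open>z\<close>, and the
  two points differ in one variable only.
\<close>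
lemma neighbour_covered:
  assumes "z \<in> kill f l"
  shows "\<exists>j\<in>occs l. \<forall>l'\<in>D ! j. z \<in> kill f l' \<longrightarrow> l' = l"
proof -
  let ?i = "lit_var l"
  let ?z = "z(?i := \<not> z ?i)"
  have z: "z \<in> zeros f" using assms kill_subset by blast
  obtain K where "K \<in> set D" and K: "eval_conj K ?z"
    using not_zero_flip[OF nonadjacent z] DNF unfolding is_DNF_def by blast
  then obtain j where j: "j < length D" "D ! j = K" by (auto simp: in_set_conv_nth)
  have only: "l' = l" if "l' \<in> K" "z \<in> kill f l'" for l'
  proof -
    have "eval_lit l' ?z" using K that by (auto simp: eval_conj_def)
    then show ?thesis using that(2) assms
      by (cases l; cases l'; auto simp: kill_def split: if_splits)
  qed
  obtain l0 where "l0 \<in> K" "z \<in> kill f l0" using clause_kills_all[OF j(1) z] j(2) by blast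
  then have "l \<in> K" using only by metis
  then show ?thesis using only j by (auto simp: occs_def)
qed

lemma occs_nonempty: "occs l \<noteq> {}"
  using reduced_kill(1)[OF reduced, of l] neighbour_covered by blast

lemma single_iff: "single l \<longleftrightarrow> (\<exists>j. occs l = {j})"
  by (simp add: single_def card_1_singleton_iff)

lemma single_disjoint:
  assumes "single l" "j < length D" "l \<in> D ! j" "l' \<in> D ! j" "l' \<noteq> l"
  shows "kill f l \<inter> kill f l' = {}"
proof -
  obtain j' where "occs l = {j'}" using assms(1) single_iff by blast
  moreover have "j \<in> occs l" using assms(2,3) by (simp add: occs_def)
  ultimately have "occs l = {j}" by simp
  then have "l' = l" if "z \<in> kill f l" "z \<in> kill f l'" for z
    using neighbour_covered[OF that(1)] that(2) assms(4) by simp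
  then show ?thesis using assms(5) by blast
qed

lemma clause_card_ge_2:
  assumes "zeros f \<noteq> {}" "j < length D"
  shows "2 \<le> card (D ! j)"
proof (rule ccontr)
  assume "\<not> ?thesis"
  then have "card (D ! j) = 0 \<or> card (D ! j) = 1" by linarith
  then obtain l where "D ! j \<subseteq> {l}" by (auto simp: card_1_singleton_iff)
  then have "zeros f \<subseteq> kill f l" using clause_kills_all[OF assms(2)] by blast
  then show False using reduced_kill(2)[OF reduced, of l] kill_subset[of f l] by blast
qed

text \<open>
  If a single literal had only one companion, they would kill complementary sets of zeros, which
  is impossible for a reduced function.
\<close>
lemma single_companions:
  assumes "single l" "j < length D" "l \<in> D ! j"
  obtains l' l'' where "l' \<in> D ! j" "l'' \<in> D ! j" "l' \<noteq> l" "l'' \<noteq> l" "l' \<noteq> l''"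
proof (rule ccontr)
  assume no: "\<not> thesis"
  note companions = that
  have uniq: "l' = l''" if "l' \<in> D ! j" "l'' \<in> D ! j" "l' \<noteq> l" "l'' \<noteq> l" for l' l''
    using no companions that by blast
  have "\<not> zeros f \<subseteq> kill f l" using reduced_kill(2)[OF reduced, of l] kill_subset[of f l] by blast
  then obtain l' where l': "l' \<in> D ! j" "l' \<noteq> l" using clause_kills_all[OF assms(2)] by blast
  have "zeros f \<subseteq> kill f l \<union> kill f l'"
    using clause_kills_all[OF assms(2)] uniq l' by blast
  moreover have "kill f l \<inter> kill f l' = {}" using single_disjoint assms l' by blast
  ultimately have "kill f l' = zeros f - kill f l" using kill_subset by blast
  then show False
    using reduced_kill_not_complement[OF reduced] clause_vars_distinct assms l' by metis
qed

lemma single_clause_card_ge_3: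
  assumes "j \<in> single_clauses"
  shows "3 \<le> card (D ! j)"
proof -
  from assms obtain l where l: "j < length D" "l \<in> D ! j" "single l"
    by (auto simp: single_clauses_def)
  obtain l' l'' where l': "l' \<in> D ! j" "l'' \<in> D ! j" "l' \<noteq> l" "l'' \<noteq> l" "l' \<noteq> l''"
    using single_companions l by metis
  then have "card {l, l', l''} = 3" by simp
  moreover have "card {l, l', l''} \<le> card (D ! j)" using l l' by (intro card_mono) simp_all
  ultimately show ?thesis by simp
qed

text \<open>
  Two single literals in one conjunction and a third literal would kill pairwise disjoint sets of
  more than a third of the zeros each.
\<close>
lemma single_unique:
  assumes "j < length D" "l \<in> D ! j" "l' \<in> D ! j" "single l" "single l'"
  shows "l = l'"
proof (rule ccontr)
  assume ne: "l \<noteq> l'"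
  obtain l'' where l'': "l'' \<in> D ! j" "l'' \<noteq> l" "l'' \<noteq> l'"
    using single_companions assms by metis
  have "kill f l \<inter> kill f l' = {}" "kill f l \<inter> kill f l'' = {}" "kill f l' \<inter> kill f l'' = {}"
    using single_disjoint assms ne l'' by metis+
  then have "card (kill f l \<union> kill f l' \<union> kill f l'')
      = card (kill f l) + card (kill f l') + card (kill f l'')"
    by (simp add: card_Un_disjoint Int_Un_distrib2)
  moreover have "card (kill f l \<union> kill f l' \<union> kill f l'') \<le> k"
    using kill_subset by (intro card_mono) auto
  ultimately show False using heavy[of l] heavy[of l'] heavy[of l''] third by linarith
qed

text \<open>
  Two companions of the single literal kill at least \<open>m\<close> zeros each, all among the at most \<open>k - m\<close>
  zeros that it does not kill. So at least \<open>3 m - k\<close> zeros are killed by both.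
\<close>
lemma killed_once_le_of_single:
  assumes "j \<in> single_clauses"
  shows "card (killed_once j) \<le> 2 * real k - 3 * m"
proof -
  from assms obtain l where l: "j < length D" "l \<in> D ! j" "single l"
    by (auto simp: single_clauses_def)
  obtain l' l'' where l': "l' \<in> D ! j" "l'' \<in> D ! j" "l' \<noteq> l" "l'' \<noteq> l" "l' \<noteq> l''"
    using single_companions l by metis
  let ?A = "kill f l" and ?B = "kill f l'" and ?C = "kill f l''"
  have "?A \<inter> (?B \<union> ?C) = {}" using single_disjoint[OF l(3,1,2)] l' by blast
  then have "card ?A + card (?B \<union> ?C) = card (?A \<union> (?B \<union> ?C))"
    by (simp add: card_Un_disjoint)
  also have "\<dots> \<le> k" using kill_subset by (intro card_mono) auto
  finally have 1: "card ?A + card (?B \<union> ?C) \<le> k" .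
  have 2: "card ?B + card ?C = card (?B \<union> ?C) + card (?B \<inter> ?C)" by (intro card_Un_Int) simp_all
  have "killed_once j \<inter> (?B \<inter> ?C) = {}" using l' by (auto simp: killed_once_def)
  then have "card (killed_once j) + card (?B \<inter> ?C) = card (killed_once j \<union> (?B \<inter> ?C))"
    by (simp add: card_Un_disjoint)
  also have "\<dots> \<le> k" using kill_subset by (intro card_mono) (auto simp: killed_once_def)
  finally show ?thesis using 1 2 heavy[of l] heavy[of l'] heavy[of l''] by linarith
qed

text \<open>
  A single literal and one companion kill disjoint sets that are not complementary. This is what
  excludes single literals when all columns are balanced.
\<close>
lemma single_clause_imp_lt_half:
  assumes "j \<in> single_clauses"
  shows "2 * m < k"
proof -
  from assms obtain l where l: "j < length D" "l \<in> D ! j" "single l"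
    by (auto simp: single_clauses_def)
  obtain l' where l': "l' \<in> D ! j" "l' \<noteq> l"
    using single_companions l by metis
  have disj: "kill f l \<inter> kill f l' = {}" using single_disjoint l l' by blast
  have "kill f l \<union> kill f l' \<noteq> zeros f"
    using reduced_kill_not_complement[OF reduced, of l l'] clause_vars_distinct[OF l(1,2) l'(1)]
      l'(2) disj by blast
  then have "kill f l \<union> kill f l' \<subset> zeros f" using kill_subset by blast
  then have "card (kill f l \<union> kill f l') < k" by (simp add: psubset_card_mono)
  then show ?thesis using disj heavy[of l] heavy[of l'] by (simp add: card_Un_disjoint)
qed

section \<open>Counting\<close>

lemma sum_killed_once_ge: "CARD('n) * k \<le> (\<Sum>j<length D. card (killed_once j))"
proof -
  let ?Q = "SIGMA j:{..<length D}. killed_once j"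
  let ?g = "\<lambda>(j, z). (lit_var (THE l. l \<in> D ! j \<and> z \<in> kill f l), z)"
  have "UNIV \<times> zeros f \<subseteq> ?g ` ?Q"
  proof clarify
    fix i z assume z: "z \<in> zeros f"
    define l where "l = (if z i then NegLit i else PosLit i)"
    have l: "lit_var l = i" "z \<in> kill f l" using z by (auto simp: l_def kill_def)
    obtain j where "j \<in> occs l" and only: "\<forall>l'\<in>D ! j. z \<in> kill f l' \<longrightarrow> l' = l"
      using neighbour_covered[OF l(2)] by blast
    then have j: "j < length D" "l \<in> D ! j" by (simp_all add: occs_def)
    then have ex1: "\<exists>!l. l \<in> D ! j \<and> z \<in> kill f l" using only l(2) by blast
    have "(THE l. l \<in> D ! j \<and> z \<in> kill f l) = l"
      using ex1 j(2) l(2) by (intro the1_equality conjI)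
    moreover have "z \<in> killed_once j" using ex1 z unfolding killed_once_def by simp
    ultimately show "(i, z) \<in> ?g ` ?Q" using j(1) l(1) by (intro image_eqI[of _ _ "(j, z)"]) simp_all
  qed
  then have "card (UNIV \<times> zeros f :: ('n \<times> _) set) \<le> card ?Q"
    by (intro surj_card_le) auto
  then show ?thesis by (simp add: card_cartesian_product)
qed

lemma dnf_rank_eq: "dnf_rank D = (\<Sum>j<length D. card (D ! j))"
  by (simp add: dnf_rank_def sum_list_sum_nth atLeast0LessThan)

lemma dnf_rank_eq_sum_occs: "dnf_rank D = (\<Sum>l\<in>UNIV. card (occs l))"
proof -
  have "dnf_rank D = (\<Sum>j<length D. \<Sum>l\<in>UNIV. if l \<in> D ! j then 1 else 0)"
    by (simp add: dnf_rank_eq sum.If_cases)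
  also have "\<dots> = (\<Sum>l\<in>UNIV. \<Sum>j<length D. if l \<in> D ! j then 1 else 0)" by (rule sum.swap)
  also have "\<dots> = (\<Sum>l\<in>UNIV. card (occs l))"
    by (intro sum.cong refl) (simp add: sum.If_cases occs_def Int_def)
  finally show ?thesis .
qed

lemma finite_single_clauses [simp]: "finite single_clauses"
  by (simp add: single_clauses_def)

lemma card_single_le: "card (Collect single) \<le> card single_clauses"
proof (rule card_inj_on_le[where f = "\<lambda>l. the_elem (occs l)"])
  have the_occ: "the_elem (occs l) < length D \<and> l \<in> D ! the_elem (occs l)" if "single l" for l
  proof -
    obtain j where j: "occs l = {j}" using \<open>single l\<close> unfolding single_iff by (rule exE)
    then have "the_elem (occs l) \<in> occs l" by simp
    then show ?thesis by (simp add: occs_def)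
  qed
  show "(\<lambda>l. the_elem (occs l)) ` Collect single \<subseteq> single_clauses"
    using the_occ unfolding single_clauses_def by blast
  show "inj_on (\<lambda>l. the_elem (occs l)) (Collect single)"
  proof (rule inj_onI)
    fix l l'
    assume "l \<in> Collect single" "l' \<in> Collect single" "the_elem (occs l) = the_elem (occs l')"
    then show "l = l'"
      using the_occ[of l] the_occ[of l'] single_unique[of "the_elem (occs l)" l l'] by simp
  qed
qed simp

lemma rank_ge_singles: "4 * CARD('n) \<le> dnf_rank D + card single_clauses"
proof -
  have "2 \<le> card (occs l) + of_bool (single l)" for l
  proof -
    have "card (occs l) \<noteq> 0" using occs_nonempty by simp
    then have "2 \<le> card (occs l)" if "\<not> single l" using that unfolding single_def by linarith
    then show ?thesis by (cases "single l") (simp_all add: single_def)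
  qed
  then have "(\<Sum>l\<in>(UNIV :: 'n lit set). 2) \<le> (\<Sum>l\<in>UNIV. card (occs l) + of_bool (single l))"
    by (intro sum_mono)
  also have "\<dots> = dnf_rank D + card (Collect single)"
    by (simp add: sum.distrib dnf_rank_eq_sum_occs)
  finally show ?thesis using card_single_le by (simp add: card_lit)
qed

lemma sum_of_bool_single_clauses:
  "(\<Sum>j<length D. of_bool (j \<in> single_clauses)) = of_nat (card single_clauses)"
proof -
  have "{..<length D} \<inter> single_clauses = single_clauses" by (auto simp: single_clauses_def)
  then show ?thesis by simp
qed

lemma rank_ge_clauses:
  assumes "zeros f \<noteq> {}"
  shows "2 * length D + card single_clauses \<le> dnf_rank D"
proof -
  have "(\<Sum>j<length D. 2 + of_bool (j \<in> single_clauses)) \<le> (\<Sum>j<length D. card (D ! j))"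
  proof (rule sum_mono)
    fix j assume "j \<in> {..<length D}"
    then show "2 + of_bool (j \<in> single_clauses) \<le> card (D ! j)"
      using clause_card_ge_2[OF assms, of j] single_clause_card_ge_3[of j] by auto
  qed
  then show ?thesis
    unfolding sum.distrib sum_of_bool_single_clauses dnf_rank_eq by simp
qed

lemma clauses_ge:
  "real CARD('n) * k + card single_clauses * (3 * m - k) \<le> real (length D) * k"
proof -
  have "real CARD('n) * k \<le> (\<Sum>j<length D. real (card (killed_once j)))"
    using sum_killed_once_ge by (simp flip: of_nat_mult of_nat_sum)
  also have "\<dots> \<le> (\<Sum>j<length D. k - of_bool (j \<in> single_clauses) * (3 * m - k))"
  proof (rule sum_mono)
    fix j
    have "card (killed_once j) \<le> k" by (intro card_mono) (auto simp: killed_once_def)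
    then show "real (card (killed_once j)) \<le> k - of_bool (j \<in> single_clauses) * (3 * m - k)"
      using killed_once_le_of_single[of j] by auto
  qed
  also have "\<dots> = real (length D) * k - card single_clauses * (3 * m - k)"
    using sum_of_bool_single_clauses[where 'a = real]
    by (simp add: sum_subtractf flip: sum_distrib_right)
  finally show ?thesis by simp
qed

text \<open>
  In \<open>k rank \<ge> 2 k N + k s\<close> the lower bound for \<open>k N\<close> makes the coefficient of \<open>s\<close> equal to
  \<open>6 m - k\<close>, so \<open>s\<close> cancels after adding \<open>rank \<ge> 4 n - s\<close> multiplied by \<open>6 m - k\<close>.
\<close>
lemma rank_ge:
  assumes "zeros f \<noteq> {}"
  shows "CARD('n) * (24 * m - 2 * real k) \<le> dnf_rank D * (6 * m)"
proof -
  let ?s = "real (card single_clauses)" and ?n = "real CARD('n)"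
  have "4 * ?n \<le> dnf_rank D + ?s" "2 * real (length D) + ?s \<le> dnf_rank D"
    using rank_ge_singles rank_ge_clauses[OF assms] by linarith+
  then have "(4 * ?n) * (6 * m - k) \<le> (dnf_rank D + ?s) * (6 * m - k)"
    "(2 * real (length D) + ?s) * k \<le> dnf_rank D * real k"
    using third by (auto intro!: mult_right_mono)
  then show ?thesis using clauses_ge by (simp add: algebra_simps)
qed

end

theorem mainTheorem1:
  fixes f :: "'n::finite boolfun" and D :: "'n lit set list"
    and n k :: nat and m \<epsilon> :: real
  assumes "n = CARD('n)" and "n > 0" and "k > 0"
    and "\<epsilon> = 2 * (real k / 2 - m) / real k"
    and "f \<in> Phi_ge k m"
    and "is_prime_DNF D f"
  shows "(\<epsilon> \<le> 1/4 \<longrightarrow>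
            real (dnf_rank D) > 10/3 * real n - 5 * real n * \<epsilon> / (3 * (1 + \<epsilon>)))
       \<and> (1/4 < \<epsilon> \<and> \<epsilon> < 1/3 \<longrightarrow>
            real (dnf_rank D) > 10/3 * real n - 13 * real n * \<epsilon> / (9 + 3 * \<epsilon>))"
proof (cases "\<epsilon> < 1/3")
  case False
  then show ?thesis by auto
next
  case True
  have m: "m = k * (1 - \<epsilon>) / 2" using assms(3,4) by (simp add: field_simps)
  have f: "reduced f" "card (zeros f) = k" "\<forall>x\<in>zeros f. \<forall>y\<in>zeros f. \<not> adjacent x y"
    "\<And>i. m \<le> weight (matrix_col (zero_matrix f) i)"
    using assms(5) by (auto simp: Phi_ge_def Phi_def)
  have "k * (1 - 3 * \<epsilon>) > 0" using assms(3) True by simp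
  then have third: "3 * m > k" by (simp add: m algebra_simps)
  interpret heavy_DNF f D m
  proof
    show "m \<le> card (kill f l)" for l
      using f(4)[of "lit_var l"] weight_le_card_kill[of f l] by linarith
  qed (use f assms(6) third in \<open>simp_all add: is_prime_DNF_def\<close>)
  have "2 * m \<le> k" 
    using f(4)[of undefined] weight_le_half[of f undefined] unfolding f(2) by linarith
  then have "\<epsilon> \<ge> 0" using assms(3,4) by simp
  have ne: "zeros f \<noteq> {}" using f(2) assms(3) by auto
  show ?thesis
  proof (cases "single_clauses = {}")
    case True
    then have "4 * real n \<le> dnf_rank D" using rank_ge_singles assms(1) by simp
    then have "10/3 * real n < dnf_rank D" using assms(2) by simp
    moreover have "0 \<le> 5 * real n * \<epsilon> / (3 * (1 + \<epsilon>))" "0 \<le> 13 * real n * \<epsilon> / (9 + 3 * \<epsilon>)"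
      using \<open>\<epsilon> \<ge> 0\<close> by simp_all
    ultimately show ?thesis by linarith
  next
    case False
    then have "2 * m < k" using single_clause_imp_lt_half f(2) by auto
    then have pos: "\<epsilon> > 0" using assms(3,4) by simp
    have "24 * m - 2 * real k = k * (10 - 12 * \<epsilon>)" "6 * m = k * (3 - 3 * \<epsilon>)"
      by (simp_all add: m field_simps)
    then have "n * (k * (10 - 12 * \<epsilon>)) \<le> dnf_rank D * (k * (3 - 3 * \<epsilon>))"
      using rank_ge[OF ne] unfolding assms(1) f(2) by metis
    then have "k * (n * (10 - 12 * \<epsilon>)) \<le> k * (dnf_rank D * (3 - 3 * \<epsilon>))"
      by (simp only: mult.left_commute)
    then have "n * (10 - 12 * \<epsilon>) \<le> dnf_rank D * (3 - 3 * \<epsilon>)" using assms(3) by simp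
    then have "n * ((10 - 12 * \<epsilon>) / (3 - 3 * \<epsilon>)) \<le> dnf_rank D"
      using True by (simp add: pos_divide_le_eq)
    moreover have "10/3 - 2 * \<epsilon> / (3 - 3 * \<epsilon>) = (10 - 12 * \<epsilon>) / (3 - 3 * \<epsilon>)"
      using True by (simp add: field_simps)
    ultimately have "n * (10/3 - 2 * \<epsilon> / (3 - 3 * \<epsilon>)) \<le> dnf_rank D" by simp
    then have *: "10/3 * n - n * \<epsilon> * (2 / (3 - 3 * \<epsilon>)) \<le> dnf_rank D"
      by (simp add: algebra_simps)
    have "2 / (3 - 3 * \<epsilon>) < 5 / (3 * (1 + \<epsilon>))" "2 / (3 - 3 * \<epsilon>) < 13 / (9 + 3 * \<epsilon>)"
      using True pos by (simp_all add: divide_simps)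
    moreover have "0 < n * \<epsilon>" using assms(2) pos by simp
    ultimately have "n * \<epsilon> * (2 / (3 - 3 * \<epsilon>)) < n * \<epsilon> * (5 / (3 * (1 + \<epsilon>)))"
      "n * \<epsilon> * (2 / (3 - 3 * \<epsilon>)) < n * \<epsilon> * (13 / (9 + 3 * \<epsilon>))"
      by (simp_all only: mult_strict_left_mono)
    moreover have "n * \<epsilon> * (5 / (3 * (1 + \<epsilon>))) = 5 * real n * \<epsilon> / (3 * (1 + \<epsilon>))"
      "n * \<epsilon> * (13 / (9 + 3 * \<epsilon>)) = 13 * real n * \<epsilon> / (9 + 3 * \<epsilon>)"
      by simp_all
    ultimately show ?thesis using * by linarith
  qed
qed

end
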